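(* Let $n\ge 1$. 1. Let $P$ be an exceptional interval-poset of size $n$. Then $\theta(P)$ is a noncrossing tree of size $n$. 2. Let $T$ be a noncrossing tree of size $n$. Then the set of relations $H(T)$ is the Hasse diagram of an exceptional interval-poset of size $n$, denoted by $\theta^{-1}(T)$. 3. $\theta$ induces a bijection between the set of exceptional interval-posets of size $n$ and the set of noncrossing trees in $\mathcal{C}_n$, with inverse $\theta^{-1}$.
   Context: An interval-poset of size $n$ is a poset $(P,\lhd)$ on $\{1,\dots,n\}$ such that for all integers $a<b<c$: $a\lhd c$ implies $b\lhd c$, and $c\lhd a$ implies $b\lhd a$. It is exceptional if its Hasse diagram contains no pair of cover relations $y\lhd z$ and $y\lhd x$ with $x<y<z$. $\mathcal{C}_n$ is a circle with $n+1$ equidistant points labeled $1,\dots,n+1$ clockwise. A noncrossing tree of size $n$ (in $\mathcal{C}_n$) is a set of edges (chords) between these points that do not cross pairwise, contain no loop, and connect any two points. An edge between $x$ and $y$ is written $[x-y]$. For an exceptional interval-poset $P$ of size $n$, let $\widehat{P}=P\sqcup\{n+1\}$ where $\lhd$ is extended by $x\lhd n+1$ for all $x\in P$. Then $\theta(P)$ is the set of edges $[i-j]$ in $\mathcal{C}_n$, one for each cover relation $i\lhd j$ of $\widehat{P}$. For a noncrossing tree $T$ of size $n$, orient each edge of $T$ towards the vertex $n+1$ (along the unique path from each vertex to $n+1$). $H(T)$ is the set of relations $i\lhd j$, $i,j\in\{1,\dots,n\}$, such that $[i-j]$ is an edge of $T$ oriented from $i$ to $j$. *)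

theory Defs
  imports "HOL-Analysis.Analysis"
begin

text \<open>
  A poset on \<open>{1..n}\<close> is given by its reflexive order relation; \<open>(x, y) \<in> r\<close> stands for
  \<open>x \<lhd> y\<close>.
\<close>

definition hasse :: "('a \<times> 'a) set \<Rightarrow> ('a \<times> 'a) set" where
  "hasse r = {(x, y). (x, y) \<in> r \<and> x \<noteq> y \<and>
                      \<not> (\<exists>z. z \<noteq> x \<and> z \<noteq> y \<and> (x, z) \<in> r \<and> (z, y) \<in> r)}"

definition interval_poset :: "nat \<Rightarrow> (nat \<times> nat) set \<Rightarrow> bool" where
  "interval_poset n P \<longleftrightarrow>
     partial_order_on {1..n} P \<and>
     (\<forall>a\<in>{1..n}. \<forall>b\<in>{1..n}. \<forall>c\<in>{1..n}. a < b \<and> b < c \<longrightarrow>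
        ((a, c) \<in> P \<longrightarrow> (b, c) \<in> P) \<and> ((c, a) \<in> P \<longrightarrow> (b, a) \<in> P))"

definition exceptional_interval_poset :: "nat \<Rightarrow> (nat \<times> nat) set \<Rightarrow> bool" where
  "exceptional_interval_poset n P \<longleftrightarrow>
     interval_poset n P \<and>
     \<not> (\<exists>x y z. x < y \<and> y < z \<and> (y, z) \<in> hasse P \<and> (y, x) \<in> hasse P)"

text \<open>
  The circle is realised as the unit circle of the complex plane, the point labelled \<open>n + 1\<close>
  being at \<open>1\<close>; the negative angle makes the labelling clockwise.  An edge \<open>[x-y]\<close> is the
  unordered pair \<open>{x, y}\<close> of its labels.
\<close>

definition circle_point :: "nat \<Rightarrow> nat \<Rightarrow> complex" where
  "circle_point n k = cis (- (2 * pi * real k / real (n + 1)))"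

text \<open>Chords that meet only in a common endpoint do not cross, hence the open segments.\<close>

definition crossing :: "nat \<Rightarrow> nat set \<Rightarrow> nat set \<Rightarrow> bool" where
  "crossing n e f \<longleftrightarrow>
     (\<exists>a b c d. e = {a, b} \<and> f = {c, d} \<and>
        open_segment (circle_point n a) (circle_point n b) \<inter>
        open_segment (circle_point n c) (circle_point n d) \<noteq> {})"

definition is_path :: "'a set set \<Rightarrow> 'a list \<Rightarrow> bool" where
  "is_path T p \<longleftrightarrow> p \<noteq> [] \<and> distinct p \<and> successively (\<lambda>x y. {x, y} \<in> T) p"

definition is_cycle :: "'a set set \<Rightarrow> 'a list \<Rightarrow> bool" where
  "is_cycle T p \<longleftrightarrow> is_path T p \<and> length p \<ge> 3 \<and> {last p, hd p} \<in> T"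

definition noncrossing_tree :: "nat \<Rightarrow> nat set set \<Rightarrow> bool" where
  "noncrossing_tree n T \<longleftrightarrow>
     (\<forall>e\<in>T. \<exists>x\<in>{1..n+1}. \<exists>y\<in>{1..n+1}. x \<noteq> y \<and> e = {x, y}) \<and>
     (\<forall>e\<in>T. \<forall>f\<in>T. e \<noteq> f \<longrightarrow> \<not> crossing n e f) \<and>
     (\<nexists>p. is_cycle T p) \<and>
     (\<forall>x\<in>{1..n+1}. \<forall>y\<in>{1..n+1}. \<exists>p. is_path T p \<and> hd p = x \<and> last p = y)"

definition hat :: "nat \<Rightarrow> (nat \<times> nat) set \<Rightarrow> (nat \<times> nat) set" where
  "hat n P = P \<union> {(x, n + 1) | x. x \<in> {1..n+1}}"

definition theta :: "nat \<Rightarrow> (nat \<times> nat) set \<Rightarrow> nat set set" where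
  "theta n P = {{i, j} | i j. (i, j) \<in> hasse (hat n P)}"

text \<open>
  An edge is oriented from \<open>i\<close> to \<open>j\<close> if the path from some vertex to \<open>n + 1\<close> traverses it in
  this direction.
\<close>

definition oriented_edges :: "nat \<Rightarrow> nat set set \<Rightarrow> (nat \<times> nat) set" where
  "oriented_edges n T =
     {(i, j). \<exists>p q. is_path T (p @ i # j # q) \<and> last (p @ i # j # q) = n + 1}"

definition tree_relations :: "nat \<Rightarrow> nat set set \<Rightarrow> (nat \<times> nat) set" where
  "tree_relations n T = {(i, j) \<in> oriented_edges n T. i \<in> {1..n} \<and> j \<in> {1..n}}"

text \<open>A partial order on a finite set is determined by its Hasse diagram.\<close>

definition theta_inv :: "nat \<Rightarrow> nat set set \<Rightarrow> (nat \<times> nat) set" where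
  "theta_inv n T = (THE P. partial_order_on {1..n} P \<and> hasse P = tree_relations n T)"

end

theory Submission
  imports Defs
begin

text \<open>
  An exceptional interval-poset is a forest in disguise. In \<open>hat n P\<close> every element has at most
  one upper cover: two covers of \<open>y\<close> on the same side of \<open>y\<close> are comparable by the
  interval condition, and two covers on different sides are what exceptionality forbids
  (\<open>single_valued_hasse_hat\<close>). So the Hasse diagram \<open>H\<close> of \<open>hat n P\<close> is the parent
  relation of a tree with root \<open>n + 1\<close>, and the simple paths towards the root only
  ascend, so that orienting the edges towards the root gives back \<open>H\<close>
  (\<open>path_to_root_ascends\<close>, \<open>oriented_edges_edges_of\<close>). Conversely, orienting a tree towards
  its root yields a single-valued acyclic relation \<open>H\<close>, and \<open>H\<close> is the Hasse diagram of its
  reflexive transitive closure (\<open>hasse_rtrancl\<close>). A finite order is determined by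
  its Hasse diagram (\<open>order_eq_hasse_rtrancl\<close>), so the two constructions are mutually inverse.

  What remains is that noncrossing edges correspond to the interval condition. By
  \<open>crossing_iff\<close>, two chords cross iff their endpoints strictly interleave. If two covers
  \<open>a \<lhd> c\<close> and \<open>b \<lhd> d\<close> interleaved, the interval condition and uniqueness of covers would
  give \<open>d \<lhd> c\<close> and \<open>c \<lhd> d\<close> (\<open>covers_do_not_cross\<close>). Conversely, let \<open>b\<close> lie between \<open>a\<close>
  and \<open>c\<close> with \<open>a \<lhd> c\<close> in a noncrossing tree. The path from \<open>b\<close> to the root leaves the arc
  between \<open>a\<close> and \<open>c\<close>, so it cannot be disjoint from the path from \<open>a\<close> to \<open>c\<close>; from a common
  vertex the path continues to \<open>c\<close>, whence \<open>b \<lhd> c\<close> (\<open>reachability_interval\<close>).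
\<close>

section \<open>Chords of the circle\<close>

definition between :: "nat \<Rightarrow> nat \<Rightarrow> nat \<Rightarrow> bool" where
  "between a b x \<longleftrightarrow> min a b < x \<and> x < max a b"

lemma between_commute: "between a b x = between b a x"
  by (auto simp: between_def)

text \<open>
  Interleaving of two pairs is a symmetric notion: \<open>c\<close> and \<open>d\<close> lie on the same side of
  \<open>a, b\<close> iff \<open>a\<close> and \<open>b\<close> lie on the same side of \<open>c, d\<close>.
\<close>

lemma between_swap:
  assumes "{a, b} \<inter> {c, d} = {}"
  shows "between a b c = between a b d \<longleftrightarrow> between c d a = between c d b"
  using assms by (auto simp: between_def min_def max_def)

text \<open>
  Twice the signed area of the triangle \<open>A B C\<close>; its sign tells on which side of the line
  \<open>A B\<close> the point \<open>C\<close> lies.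
\<close>

definition orient :: "complex \<Rightarrow> complex \<Rightarrow> complex \<Rightarrow> real" where
  "orient A B C = Re (B - A) * Im (C - A) - Im (B - A) * Re (C - A)"

lemma orient_cis:
  "orient (cis (2 * u)) (cis (2 * v)) (cis (2 * w)) =
     4 * sin (v - u) * sin (w - v) * sin (w - u)"
proof -
  define x y where "x = v - u" and "y = w - v"
  have "orient (cis (2 * u)) (cis (2 * v)) (cis (2 * w)) =
      sin (2 * w - 2 * v) + sin (2 * v - 2 * u) - sin (2 * w - 2 * u)"
    unfolding orient_def sin_diff by (simp add: algebra_simps)
  also have "\<dots> = sin (2 * y) + sin (2 * x) - sin (2 * x + 2 * y)"
    by (simp add: x_def y_def algebra_simps)
  also have "\<dots> = 4 * sin x * sin y * (sin x * cos y + cos x * sin y)"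
  proof -
    have *: "(cos x)\<^sup>2 = 1 - (sin x)\<^sup>2" "(cos y)\<^sup>2 = 1 - (sin y)\<^sup>2"
      by (simp_all add: cos_squared_eq)
    have "sin (2 * y) + sin (2 * x) - sin (2 * x + 2 * y) =
      2 * sin x * cos x * (1 - cos (2 * y)) + 2 * sin y * cos y * (1 - cos (2 * x))"
      unfolding sin_add sin_double by (simp add: algebra_simps)
    also have "\<dots> = 2 * sin x * cos x * (2 * (sin y)\<^sup>2) + 2 * sin y * cos y * (2 * (sin x)\<^sup>2)"
      by (simp add: cos_double *)
    finally show ?thesis by (simp add: power2_eq_square algebra_simps)
  qed
  also have "sin x * cos y + cos x * sin y = sin (w - u)"
    by (simp add: x_def y_def flip: sin_add)
  finally show ?thesis by (simp add: x_def y_def)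
qed

text \<open>
  Labels increase clockwise, so a triangle with increasing labels is negatively oriented.
  The half angles of any two of its vertices differ by less than \<open>pi\<close>, which makes the three
  sines in \<open>orient_cis\<close> negative.
\<close>

lemma orient_circle_point_neg:
  assumes "a < b" "b < c" "0 < a" "c \<le> n + 1"
  shows "orient (circle_point n a) (circle_point n b) (circle_point n c) < 0"
proof -
  define t where "t k = - (pi * real k / real (n + 1))" for k
  have cp: "circle_point n k = cis (2 * t k)" for k
    by (simp add: circle_point_def t_def algebra_simps)
  have neg: "sin (t y - t x) < 0" if "x < y" "0 < x" "y \<le> n + 1" for x y
  proof -
    have "t x - t y = pi * (real y - real x) / real (n + 1)"
      by (simp add: t_def right_diff_distrib diff_divide_distrib)
    moreover have "pi * (real y - real x) / real (n + 1) < pi"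
      using that by (simp add: pos_divide_less_eq)
    moreover have "0 < pi * (real y - real x) / real (n + 1)"
      using that by simp
    ultimately have "sin (t x - t y) > 0"
      by (intro sin_gt_zero) auto
    then show ?thesis
      using sin_minus[of "t x - t y"] by simp
  qed
  have "sin (t b - t a) < 0" "sin (t c - t b) < 0" "sin (t c - t a) < 0"
    using assms by (auto intro!: neg)
  then show ?thesis
    unfolding cp orient_cis by (simp add: mult_less_0_iff zero_less_mult_iff)
qed

lemma orient_convex_combination:
  "orient A B ((1 - t) *\<^sub>R C + t *\<^sub>R D) = (1 - t) * orient A B C + t * orient A B D"
  by (simp add: orient_def algebra_simps)

lemma orient_line: "orient A B ((1 - t) *\<^sub>R A + t *\<^sub>R B) = 0"
  by (simp add: orient_def algebra_simps)

lemma orient_rotate: "orient A B C = orient B C A" and orient_swap: "orient A B C = - orient B A C"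
  by (simp_all add: orient_def algebra_simps)

text \<open>
  The hypotheses say that \<open>A B C D\<close> is a convex quadrilateral. Four points of the plane
  satisfy the affine dependence \<open>[BCD] A + [ABD] C = [ACD] B + [ABC] D\<close>, whose coefficients have
  the same sum on both sides; dividing by this sum exhibits the common point of the diagonals.
\<close>

lemma diagonals_meet:
  assumes "orient A B C < 0" "orient A B D < 0" "orient A C D < 0" "orient B C D < 0"
  shows "open_segment A C \<inter> open_segment B D \<noteq> {}"
proof -
  define s where "s = orient B C D + orient A B D"
  have s: "s = orient A C D + orient A B C"
    by (simp add: s_def orient_def algebra_simps)
  have s_neg: "s < 0"
    using assms by (simp add: s_def)
  define t u where "t = orient A B D / s" and "u = orient A B C / s"
  have "orient B C D *\<^sub>R A + orient A B D *\<^sub>R C = orient A C D *\<^sub>R B + orient A B C *\<^sub>R D"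
    by (simp add: complex_eq_iff orient_def algebra_simps)
  then have "(1 / s) *\<^sub>R (orient B C D *\<^sub>R A + orient A B D *\<^sub>R C) =
      (1 / s) *\<^sub>R (orient A C D *\<^sub>R B + orient A B C *\<^sub>R D)"
    by (rule arg_cong)
  then have "(orient B C D / s) *\<^sub>R A + t *\<^sub>R C = (orient A C D / s) *\<^sub>R B + u *\<^sub>R D"
    by (simp add: scaleR_add_right t_def u_def)
  moreover have "orient B C D / s = 1 - t"
    unfolding t_def by (subst s_def) (use s_neg in \<open>simp add: field_simps s_def\<close>)
  moreover have "orient A C D / s = 1 - u"
    using s_neg s by (simp add: u_def field_simps)
  ultimately have eq: "(1 - t) *\<^sub>R A + t *\<^sub>R C = (1 - u) *\<^sub>R B + u *\<^sub>R D"
    by simp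
  have "0 < t" "t < 1" "0 < u" "u < 1"
    using assms s_neg s unfolding t_def u_def
    by (auto simp: divide_neg_neg neg_divide_less_eq s_def)
  moreover have "A \<noteq> C" "B \<noteq> D"
    using assms by (auto simp: orient_def)
  ultimately show ?thesis
    using eq by (auto simp: in_segment disjoint_iff)
qed

text \<open>
  The function \<open>orient A B\<close> is affine and vanishes on the segment \<open>A B\<close>, but it has a strict
  sign inside the segment \<open>C D\<close>.
\<close>

lemma same_side_disjoint:
  assumes "orient A B C \<le> 0 \<and> orient A B D \<le> 0 \<or> 0 \<le> orient A B C \<and> 0 \<le> orient A B D"
    and "orient A B C \<noteq> 0 \<or> orient A B D \<noteq> 0"
  shows "open_segment A B \<inter> open_segment C D = {}"
proof (rule ccontr)
  assume "open_segment A B \<inter> open_segment C D \<noteq> {}"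
  then obtain z where z: "z \<in> open_segment A B" "z \<in> open_segment C D"
    by auto
  obtain t where t: "0 < t" "t < 1" "z = (1 - t) *\<^sub>R C + t *\<^sub>R D"
    using z(2) by (auto simp: in_segment)
  have "orient A B z = 0"
    using z(1) by (auto simp: in_segment orient_line)
  then have "(1 - t) * orient A B C + t * orient A B D = 0"
    by (simp add: t orient_convex_combination)
  moreover have "(1 - t) * orient A B C \<le> 0 \<and> t * orient A B D \<le> 0 \<or>
      0 \<le> (1 - t) * orient A B C \<and> 0 \<le> t * orient A B D"
    using assms(1) t by (auto simp: mult_le_0_iff zero_le_mult_iff)
  ultimately have "(1 - t) * orient A B C = 0 \<and> t * orient A B D = 0"
    by linarith
  then show False
    using assms(2) t by simp
qed

lemma chords_meet_iff:
  assumes V: "{a, b, c, d} \<subseteq> {1..n+1}" and ne: "a \<noteq> b" "c \<noteq> d" "{a, b} \<noteq> {c, d}"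
  shows "open_segment (circle_point n a) (circle_point n b) \<inter>
      open_segment (circle_point n c) (circle_point n d) \<noteq> {} \<longleftrightarrow>
    {a, b} \<inter> {c, d} = {} \<and> between a b c \<noteq> between a b d"
  (is "?meet a b c d \<longleftrightarrow> _")
proof -
  have sorted: "?meet a b c d \<longleftrightarrow> {a, b} \<inter> {c, d} = {} \<and> between a b c \<noteq> between a b d"
    if "{a, b, c, d} \<subseteq> {1..n+1}" "a < b" "c < d" "{a, b} \<noteq> {c, d}" for a b c d
  proof -
    let ?L = "\<lambda>x. orient (circle_point n a) (circle_point n b) (circle_point n x)"
    have inside: "0 < ?L x" if "a < x" "x < b" for x
      using orient_circle_point_neg[of a x b n] that \<open>{a, b, c, d} \<subseteq> {1..n+1}\<close>
      by (subst orient_swap, subst orient_rotate, subst orient_rotate) (auto simp: orient_def algebra_simps)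
    have outside: "?L x < 0" if "x < a \<or> b < x" "x \<in> {1..n+1}" for x
      using that
    proof (elim disjE)
      assume "x < a"
      then have "orient (circle_point n x) (circle_point n a) (circle_point n b) < 0"
        using \<open>a < b\<close> that(2) \<open>{a, b, c, d} \<subseteq> _\<close> by (intro orient_circle_point_neg) auto
      then show ?thesis by (simp add: orient_rotate)
    next
      assume "b < x"
      then show ?thesis
        using \<open>a < b\<close> that(2) \<open>{a, b, c, d} \<subseteq> _\<close> by (intro orient_circle_point_neg) auto
    qed
    have on: "?L a = 0" "?L b = 0"
      by (simp_all add: orient_def)
    show ?thesis
    proof (cases "{a, b} \<inter> {c, d} = {} \<and> between a b c \<noteq> between a b d")
      case True
      then have "a < c \<and> c < b \<and> b < d \<or> c < a \<and> a < d \<and> d < b"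
        using that(2,3) unfolding between_def by auto
      then consider "a < c" "c < b" "b < d" | "c < a" "a < d" "d < b"
        by blast
      then have "?meet a b c d"
      proof cases
        case 1
        then show ?thesis
          using that by (intro diagonals_meet orient_circle_point_neg) auto
      next
        case 2
        then have "?meet c d a b"
          using that by (intro diagonals_meet orient_circle_point_neg) auto
        then show ?thesis by (simp add: Int_commute)
      qed
      with True show ?thesis by simp
    next
      case False
      have "c \<in> {a..b} \<and> d \<in> {a..b} \<or> c \<notin> {a<..<b} \<and> d \<notin> {a<..<b}"
        using False that(2,3) unfolding between_def by auto
      then consider "c \<in> {a..b}" "d \<in> {a..b}" | "c \<notin> {a<..<b}" "d \<notin> {a<..<b}"
        by blast
      then have "?L c \<le> 0 \<and> ?L d \<le> 0 \<or> 0 \<le> ?L c \<and> 0 \<le> ?L d"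
      proof cases
        case 1
        have "0 \<le> ?L x" if "x \<in> {a..b}" for x
          using that inside[of x] on by (cases "x = a \<or> x = b") auto
        with 1 show ?thesis by blast
      next
        case 2
        have "?L x \<le> 0" if "x \<notin> {a<..<b}" "x \<in> {1..n+1}" for x
          using that outside[of x] on by (cases "x = a \<or> x = b") auto
        with 2 that(1) show ?thesis by blast
      qed
      moreover have "?L c \<noteq> 0 \<or> ?L d \<noteq> 0"
      proof -
        have "x = a \<or> x = b" if "?L x = 0" "x \<in> {1..n+1}" for x
          using inside[of x] outside[of x] that by (cases x a rule: linorder_cases; cases x b rule: linorder_cases) auto
        then show ?thesis
          using that(1)[THEN subsetD, of c] that(1)[THEN subsetD, of d] that(2-4) by blast
      qed
      ultimately have "\<not> ?meet a b c d"
        by (simp add: same_side_disjoint)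
      with False show ?thesis by simp
    qed
  qed
  have swap: "?meet a b c d = ?meet b a c d" "?meet a b c d = ?meet a b d c"
    by (simp_all add: open_segment_commute)
  have comm: "between a b c = between b a c" "between a b d = between b a d"
    by (simp_all add: between_commute)
  consider "a < b" "c < d" | "b < a" "c < d" | "a < b" "d < c" | "b < a" "d < c"
    using ne(1,2) by linarith
  then show ?thesis
  proof cases
    case 1
    then show ?thesis using sorted[of a b c d] V ne by blast
  next
    case 2
    then show ?thesis using sorted[of b a c d] V ne swap comm by (simp add: insert_commute)
  next
    case 3
    then show ?thesis using sorted[of a b d c] V ne swap by (simp add: insert_commute) blast
  next
    case 4
    then have "?meet b a d c \<longleftrightarrow> {b, a} \<inter> {d, c} = {} \<and> between b a d \<noteq> between b a c"
      using V ne by (intro sorted) (auto simp: insert_commute)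
    moreover have "?meet a b c d = ?meet b a d c"
      by (simp add: open_segment_commute)
    ultimately show ?thesis using comm by (simp add: insert_commute) blast
  qed
qed

text \<open>
  All later arguments about the circle use only this combinatorial description.
\<close>

lemma crossing_iff:
  assumes V: "{a, b, c, d} \<subseteq> {1..n+1}" and ne: "a \<noteq> b" "c \<noteq> d" "{a, b} \<noteq> {c, d}"
  shows "crossing n {a, b} {c, d} \<longleftrightarrow>
    {a, b} \<inter> {c, d} = {} \<and> between a b c \<noteq> between a b d"
proof -
  have "crossing n {a, b} {c, d} \<longleftrightarrow>
      open_segment (circle_point n a) (circle_point n b) \<inter>
      open_segment (circle_point n c) (circle_point n d) \<noteq> {}"
    unfolding crossing_def by (metis doubleton_eq_iff open_segment_commute)
  then show ?thesis
    using chords_meet_iff[OF assms] by simp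
qed



section \<open>Hasse diagrams of finite orders\<close>

lemma hasseD: "(x, y) \<in> hasse r \<Longrightarrow> (x, y) \<in> r \<and> x \<noteq> y"
  by (simp add: hasse_def)

lemma hasse_no_middle: "(x, y) \<in> hasse r \<Longrightarrow> (x, z) \<in> r \<Longrightarrow> (z, y) \<in> r \<Longrightarrow> z = x \<or> z = y"
  by (auto simp: hasse_def)

text \<open>
  A relation \<open>x \<le> y\<close> is refined to a chain of covers by induction on the size of the interval
  from \<open>x\<close> to \<open>y\<close>, splitting it at any intermediate point.
\<close>

lemma order_eq_hasse_rtrancl:
  assumes po: "partial_order_on A P" and fin: "finite A"
  shows "P = (hasse P)\<^sup>* \<inter> A \<times> A"
proof -
  have tr: "(x, z) \<in> P" if "(x, y) \<in> P" "(y, z) \<in> P" for x y z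
    using partial_order_onD(2)[OF po] that by (rule transD)
  have as: "x = y" if "(x, y) \<in> P" "(y, x) \<in> P" for x y
    using partial_order_onD(3)[OF po] that by (rule antisymD)
  have sub: "P \<subseteq> A \<times> A"
    using partial_order_onD(4)[OF po] .
  have up: "(x, y) \<in> (hasse P)\<^sup>*" if "(x, y) \<in> P" for x y
    using that
  proof (induction "card {z. (x, z) \<in> P \<and> (z, y) \<in> P}" arbitrary: x y rule: less_induct)
    case less
    let ?I = "\<lambda>x y. {z. (x, z) \<in> P \<and> (z, y) \<in> P}"
    have finI: "finite (?I x y)" for x y
      by (rule finite_subset[OF _ fin]) (use sub in auto)
    show ?case
    proof (cases "x = y \<or> (x, y) \<in> hasse P")
      case False
      then obtain z where z: "z \<noteq> x" "z \<noteq> y" "(x, z) \<in> P" "(z, y) \<in> P"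
        using less.prems by (auto simp: hasse_def)
      have "(x, x) \<in> P" "(y, y) \<in> P"
        using less.prems sub partial_order_onD(1)[OF po] by (auto simp: refl_on_def)
      with less.prems have xy: "x \<in> ?I x y" "y \<in> ?I x y" by auto
      have "?I x z \<subset> ?I x y"
        using z tr as xy(2) by blast
      moreover have "?I z y \<subset> ?I x y"
        using z tr as xy(1) by blast
      ultimately have "(x, z) \<in> (hasse P)\<^sup>*" "(z, y) \<in> (hasse P)\<^sup>*"
        using less.hyps[OF psubset_card_mono[OF finI]] z by blast+
      then show ?thesis by (rule rtrancl_trans)
    qed auto
  qed
  have down: "(x, y) \<in> P" if "(x, y) \<in> (hasse P)\<^sup>*" "x \<in> A" for x y
    using that
  proof (induction rule: rtrancl_induct)
    case base
    then show ?case using partial_order_onD(1)[OF po] by (auto simp: refl_on_def)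
  next
    case (step y z)
    then show ?case using hasseD tr by fast
  qed
  show ?thesis
    using up down sub by auto
qed

lemma partial_order_on_hat:
  assumes "partial_order_on {1..n} P"
  shows "partial_order_on {1..n+1} (hat n P)"
proof -
  have P: "P \<subseteq> {1..n} \<times> {1..n}" "refl_on {1..n} P" "trans P" "antisym P"
    using partial_order_onD[OF assms] by auto
  have top: "(n + 1, x) \<notin> P" "(x, n + 1) \<notin> P" for x
    using P(1) by auto
  have "refl_on {1..n+1} (hat n P)"
    using P(2) by (auto simp: refl_on_def hat_def)
  moreover have "trans (hat n P)"
  proof (rule transI)
    fix x y z
    assume "(x, y) \<in> hat n P" "(y, z) \<in> hat n P"
    then show "(x, z) \<in> hat n P"
      using P(1) transD[OF P(3)] top by (fastforce simp: hat_def)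
  qed
  moreover have "antisym (hat n P)"
    using antisymD[OF P(4)] top by (auto simp: hat_def antisym_def)
  moreover have "hat n P \<subseteq> {1..n+1} \<times> {1..n+1}"
    using P(1) by (auto simp: hat_def)
  ultimately show ?thesis
    by (simp add: partial_order_on_def preorder_on_def)
qed

text \<open>
  The added top element is never strictly between two elements of \<open>P\<close>, so it neither
  creates nor destroys covers of \<open>P\<close>.
\<close>

lemma hasse_hat_restrict:
  assumes P: "P \<subseteq> {1..n} \<times> {1..n}"
  shows "{(i, j) \<in> hasse (hat n P). i \<in> {1..n} \<and> j \<in> {1..n}} = hasse P"
proof -
  have "(x, y) \<in> hat n P \<longleftrightarrow> (x, y) \<in> P" if "y \<noteq> n + 1" for x y
    using that by (auto simp: hat_def)
  moreover have "(n + 1, y) \<notin> hat n P" if "y \<noteq> n + 1" for y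
    using P that by (auto simp: hat_def)
  moreover have "x \<in> {1..n}" "y \<in> {1..n}" if "(x, y) \<in> P" for x y
    using P that by auto
  ultimately show ?thesis
    using P by (auto simp: hasse_def) (metis Suc_n_not_le_n)+
qed

section \<open>Simple paths in acyclic graphs\<close>

lemma is_path_Cons:
  "is_path T (x # xs) \<longleftrightarrow> x \<notin> set xs \<and> (xs = [] \<or> {x, hd xs} \<in> T \<and> is_path T xs)"
  by (auto simp: is_path_def successively_Cons)

lemma is_path_append:
  "xs \<noteq> [] \<Longrightarrow> ys \<noteq> [] \<Longrightarrow> is_path T (xs @ ys) \<longleftrightarrow>
     is_path T xs \<and> is_path T ys \<and> set xs \<inter> set ys = {} \<and> {last xs, hd ys} \<in> T"
  by (auto simp: is_path_def successively_append_iff)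

lemma is_path_rev: "is_path T (rev xs) \<longleftrightarrow> is_path T xs"
  by (simp add: is_path_def insert_commute)

lemma is_path_suffix: "is_path T (xs @ ys) \<Longrightarrow> ys \<noteq> [] \<Longrightarrow> is_path T ys"
  by (cases "xs = []") (auto simp: is_path_append)

lemma is_path_prefix: "is_path T (xs @ ys) \<Longrightarrow> xs \<noteq> [] \<Longrightarrow> is_path T xs"
  by (cases "ys = []") (auto simp: is_path_append)

text \<open>
  Follow the first path up to the first vertex \<open>v\<close> that it shares with the second one, then
  return from \<open>v\<close> to \<open>x\<close> along the second path.
\<close>

lemma two_paths_cycle:
  assumes "is_path T (x # y # ys)" "is_path T (x # z # zs)" "y \<noteq> z"
    and last: "last (y # ys) = last (z # zs)"
  shows "\<exists>p. is_cycle T p"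
proof -
  have "last (y # ys) \<in> set (y # ys)"
    by (rule last_in_set) simp
  then have "\<exists>v\<in>set (y # ys). v \<in> set (z # zs)"
    using last_in_set[of "z # zs"] last by auto
  then obtain u v w where u: "y # ys = u @ v # w" "v \<in> set (z # zs)" "\<forall>a\<in>set u. a \<notin> set (z # zs)"
    using split_list_first_prop[of "y # ys" "\<lambda>v. v \<in> set (z # zs)"] by blast
  obtain u' w' where u': "z # zs = u' @ v # w'"
    using split_list[OF u(2)] by auto
  have p1: "is_path T ((x # u @ [v]) @ w)"
    using assms(1) u(1) by simp
  have p2: "is_path T ((x # u' @ [v]) @ w')"
    using assms(2) u' by simp
  have p1: "is_path T (x # u @ [v])" and p2: "is_path T (x # u' @ [v])"
    using p1 p2 by (blast intro: is_path_prefix)+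
  have disj: "set (x # u @ [v]) \<inter> set u' = {}"
    using u(3) u' p2 by (auto simp: is_path_def)
  have yz: "hd (u @ [v]) = y" "hd (u' @ [v]) = z"
    using arg_cong[OF u(1), of hd] arg_cong[OF u', of hd] by (simp_all add: hd_append split: if_splits)
  have "is_path T ((x # u @ [v]) @ rev u')"
  proof (cases "u' = []")
    case False
    have "is_path T (u' @ [v])"
      using p2 by (simp add: is_path_Cons)
    then have "is_path T u'" "{v, last u'} \<in> T"
      using False by (auto simp: is_path_append insert_commute)
    then show ?thesis
      using False p1 disj by (subst is_path_append) (auto simp: is_path_rev hd_rev)
  qed (use p1 in simp)
  \<comment> \<open>If both \<open>u\<close> and \<open>u'\<close> were empty, \<open>y\<close> and \<open>z\<close> would both be \<open>v\<close>.\<close>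
  moreover have "length ((x # u @ [v]) @ rev u') \<ge> 3"
    using yz assms(3) by (cases u; cases u') auto
  moreover have "last ((x # u @ [v]) @ rev u') = z"
    using yz by (cases u') auto
  moreover have "{z, x} \<in> T"
    using assms(2) by (simp add: is_path_Cons insert_commute)
  ultimately have "is_cycle T ((x # u @ [v]) @ rev u')"
    by (simp add: is_cycle_def)
  then show ?thesis by blast
qed

lemma path_unique:
  assumes acyc: "\<nexists>p. is_cycle T p"
    and "is_path T xs" "is_path T ys" "hd xs = hd ys" "last xs = last ys"
  shows "xs = ys"
  using assms(2-)
proof (induction xs arbitrary: ys)
  case Nil
  then show ?case by (simp add: is_path_def)
next
  case (Cons x xs)
  obtain ys' where ys: "ys = x # ys'"
    using Cons.prems by (cases ys) (auto simp: is_path_def)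
  show ?case
  proof (cases "xs = [] \<or> ys' = []")
    case True
    then show ?thesis
      using Cons.prems ys last_in_set[of xs] last_in_set[of ys'] by (auto simp: is_path_Cons split: if_splits)
  next
    case False
    then obtain y ys'' z zs where *: "xs = y # ys''" "ys' = z # zs"
      by (metis neq_Nil_conv)
    have "y = z"
      using two_paths_cycle[of T x y ys'' z zs] acyc Cons.prems ys * by auto
    then show ?thesis
      using Cons.IH[of ys'] Cons.prems ys * by (auto simp: is_path_Cons)
  qed
qed

text \<open>
  Turns a walk into a simple path: prepending a vertex that already occurs is replaced by
  cutting the path at that occurrence.
\<close>

lemma ex_path_if_rtrancl:
  assumes "(x, y) \<in> {(u, v). {u, v} \<in> T}\<^sup>*"
  shows "\<exists>p. is_path T p \<and> hd p = x \<and> last p = y"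
  using assms
proof (induction rule: converse_rtrancl_induct)
  case base
  have "is_path T [y]" by (simp add: is_path_def)
  then show ?case by force
next
  case (step u v)
  then obtain p where p: "is_path T p" "hd p = v" "last p = y" by blast
  show ?case
  proof (cases "u \<in> set p")
    case True
    then obtain q r where qr: "p = q @ u # r"
      by (meson split_list)
    then have "is_path T (u # r)"
      using p(1) is_path_suffix by blast
    then show ?thesis
      using p(3) qr by force
  next
    case False
    then have "is_path T (u # p)"
      using p step(1) by (auto simp: is_path_Cons)
    moreover have "last (u # p) = y"
      using p by (auto simp: is_path_def)
    ultimately show ?thesis by force
  qed
qed


section \<open>Forests\<close>

lemma cycle_two_neighbours:
  assumes "is_cycle T p" "m \<in> set p"
  shows "\<exists>u v. u \<noteq> v \<and> u \<in> set p \<and> v \<in> set p \<and> {m, u} \<in> T \<and> {m, v} \<in> T"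
proof -
  obtain xs ys where p: "p = xs @ m # ys"
    using assms(2) by (meson split_list)
  \<comment> \<open>The cycle without \<open>m\<close>, read from its successor to its predecessor.\<close>
  define q where "q = ys @ xs"
  have c: "distinct p" "successively (\<lambda>x y. {x, y} \<in> T) p" "length p \<ge> 3" "{last p, hd p} \<in> T"
    using assms(1) by (auto simp: is_cycle_def is_path_def)
  have "length q \<ge> 2" "distinct q" "set q \<subseteq> set p"
    using c by (auto simp: p q_def)
  then obtain u w v where q: "q = u # w @ [v]"
    by (cases q; cases "tl q" rule: rev_cases) auto
  have "{m, hd q} \<in> T"
    using c(2,4) \<open>length q \<ge> 2\<close>
    by (cases ys) (auto simp: p q_def successively_append_iff successively_Cons hd_append split: if_splits)
  moreover have "{m, last q} \<in> T"
    using c(2,4) \<open>length q \<ge> 2\<close>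
    by (cases xs rule: rev_cases)
      (auto simp: p q_def successively_append_iff insert_commute split: if_splits)
  ultimately show ?thesis
    using \<open>distinct q\<close> \<open>set q \<subseteq> set p\<close> by (intro exI[of _ u] exI[of _ v]) (auto simp: q)
qed

definition edges_of :: "('a \<times> 'a) set \<Rightarrow> 'a set set" where
  "edges_of H = {{i, j} | i j. (i, j) \<in> H}"

lemma edges_of_iff: "{i, j} \<in> edges_of H \<longleftrightarrow> (i, j) \<in> H \<or> (j, i) \<in> H"
  by (auto simp: edges_of_def doubleton_eq_iff)

text \<open>
  On a cycle, take a vertex \<open>m\<close> that is minimal for \<open>H\<close>: both of its neighbours on the cycle
  would be successors of \<open>m\<close>, but \<open>H\<close> allows only one.
\<close>

lemma edges_of_single_valued_acyclic:
  assumes "wf H" "single_valued H"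
  shows "\<nexists>p. is_cycle (edges_of H) p"
proof
  assume "\<exists>p. is_cycle (edges_of H) p"
  then obtain p where p: "is_cycle (edges_of H) p" by blast
  then have "set p \<noteq> {}"
    by (auto simp: is_cycle_def is_path_def)
  then obtain m where m: "m \<in> set p" "\<And>x. (x, m) \<in> H \<Longrightarrow> x \<notin> set p"
    using wfE_min'[OF assms(1), of "set p"] by blast
  then obtain u v where "u \<noteq> v" "u \<in> set p" "v \<in> set p" "{m, u} \<in> edges_of H" "{m, v} \<in> edges_of H"
    using cycle_two_neighbours[OF p] by blast
  then have "(m, u) \<in> H" "(m, v) \<in> H"
    using m(2) unfolding edges_of_iff by blast+
  with \<open>u \<noteq> v\<close> show False
    using single_valuedD[OF assms(2)] by blast
qed

text \<open>
  The last step of such a path ascends because the root has no successor. If the step after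
  \<open>i, j\<close> ascends to \<open>k\<close>, then a descending step from \<open>i\<close> to \<open>j\<close> would make \<open>i\<close> a successor of
  \<open>j\<close> too, hence equal to \<open>k\<close>, and the path would not be simple.
\<close>

lemma path_to_root_ascends:
  assumes sv: "single_valued H" and root: "\<And>j. (r, j) \<notin> H"
  shows "is_path (edges_of H) (i # j # q) \<Longrightarrow> last (j # q) = r \<Longrightarrow> (i, j) \<in> H"
proof (induction q arbitrary: i j)
  case Nil
  then show ?case
    using root by (auto simp: is_path_Cons edges_of_iff)
next
  case (Cons k q)
  have "is_path (edges_of H) (j # k # q)"
    using Cons.prems(1) by (simp add: is_path_Cons)
  then have "(j, k) \<in> H"
    using Cons by simp
  moreover have "i \<noteq> k" "(i, j) \<in> H \<or> (j, i) \<in> H"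
    using Cons.prems(1) by (auto simp: is_path_Cons edges_of_iff)
  ultimately show ?case
    using single_valuedD[OF sv] by blast
qed

lemma oriented_edges_iff:
  "(i, j) \<in> oriented_edges n T \<longleftrightarrow> (\<exists>q. is_path T (i # j # q) \<and> last (j # q) = n + 1)"
proof
  assume "(i, j) \<in> oriented_edges n T"
  then obtain p q where p: "is_path T (p @ i # j # q)" "last (p @ i # j # q) = n + 1"
    unfolding oriented_edges_def by blast
  have "is_path T (i # j # q)"
    using p(1) by (rule is_path_suffix) simp
  moreover have "last (j # q) = n + 1"
    using p(2) by simp
  ultimately show "\<exists>q. is_path T (i # j # q) \<and> last (j # q) = n + 1"
    by blast
next
  assume "\<exists>q. is_path T (i # j # q) \<and> last (j # q) = n + 1"
  then obtain q where q: "is_path T (i # j # q)" "last (j # q) = n + 1"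
    by blast
  have "is_path T ([] @ i # j # q)" "last ([] @ i # j # q) = n + 1"
    using q by simp_all
  then show "(i, j) \<in> oriented_edges n T"
    unfolding oriented_edges_def by blast
qed

lemma path_if_reachable:
  assumes "\<And>x. x \<in> V \<Longrightarrow> (x, r) \<in> H\<^sup>*" "x \<in> V" "y \<in> V"
  shows "\<exists>p. is_path (edges_of H) p \<and> hd p = x \<and> last p = y"
proof (rule ex_path_if_rtrancl)
  let ?E = "{(u, v). {u, v} \<in> edges_of H}"
  have "H\<^sup>* \<subseteq> ?E\<^sup>*"
    by (intro rtrancl_mono) (auto simp: edges_of_iff)
  moreover have "sym (?E\<^sup>*)"
    by (intro sym_rtrancl) (auto simp: sym_def insert_commute)
  ultimately show "(x, y) \<in> ?E\<^sup>*"
    using assms by (meson rtrancl_trans subsetD symD)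
qed

text \<open>
  Orientation towards the root recovers the parent relation of a rooted tree.
\<close>

lemma oriented_edges_edges_of:
  assumes sv: "single_valued H" and root: "\<And>j. (n + 1, j) \<notin> H"
    and reach: "\<And>x. x \<in> V \<Longrightarrow> (x, n + 1) \<in> H\<^sup>*" and V: "H \<subseteq> V \<times> V" "n + 1 \<in> V"
  shows "oriented_edges n (edges_of H) = H"
proof (rule set_eqI, clarify, rule iffI)
  fix i j
  assume "(i, j) \<in> oriented_edges n (edges_of H)"
  then show "(i, j) \<in> H"
    using path_to_root_ascends[OF sv root] unfolding oriented_edges_iff by blast
next
  fix i j
  assume ij: "(i, j) \<in> H"
  then obtain p where p: "is_path (edges_of H) p" "hd p = i" "last p = n + 1"
    using path_if_reachable[of V "n + 1" H i "n + 1"] reach V by blast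
  have "i \<noteq> n + 1"
    using ij root by blast
  then obtain k q where kq: "p = i # k # q"
    using p by (cases p; cases "tl p") (auto simp: is_path_def)
  have path: "is_path (edges_of H) (i # k # q)" "last (k # q) = n + 1"
    using p(1,3) by (simp_all add: kq)
  then have "(i, k) \<in> oriented_edges n (edges_of H)"
    unfolding oriented_edges_iff by blast
  moreover have "(i, k) \<in> H"
    using path_to_root_ascends[OF sv root] path by blast
  ultimately show "(i, j) \<in> oriented_edges n (edges_of H)"
    using single_valuedD[OF sv ij] by blast
qed

lemma partial_order_on_rtrancl:
  assumes "acyclic H"
  shows "partial_order_on V (H\<^sup>* \<inter> V \<times> V)"
proof -
  have "trans (H\<^sup>* \<inter> V \<times> V)"
    by (intro trans_Int trans_rtrancl) (auto intro: transI)
  moreover have "antisym (H\<^sup>* \<inter> V \<times> V)"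
    using acyclic_impl_antisym_rtrancl[OF assms] unfolding antisym_def by blast
  ultimately show ?thesis
    unfolding partial_order_on_def preorder_on_def refl_on_def by blast
qed

text \<open>
  The unique chain upwards from \<open>i\<close> starts with its successor, so nothing fits between \<open>i\<close> and
  that successor.
\<close>

lemma hasse_rtrancl:
  assumes "acyclic H" "single_valued H" "H \<subseteq> V \<times> V"
  shows "hasse (H\<^sup>* \<inter> V \<times> V) = H"
proof (rule set_eqI, clarify, rule iffI)
  fix i j
  assume ij: "(i, j) \<in> hasse (H\<^sup>* \<inter> V \<times> V)"
  then have "(i, j) \<in> H\<^sup>*" "i \<noteq> j" and V: "i \<in> V" "j \<in> V"
    by (auto simp: hasse_def)
  then obtain k where k: "(i, k) \<in> H" "(k, j) \<in> H\<^sup>*"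
    by (meson converse_rtranclE)
  then have "k \<noteq> i" "k \<in> V"
    using assms(1,3) by (auto simp: acyclic_def)
  then show "(i, j) \<in> H"
    using hasse_no_middle[OF ij, of k] k V by blast
next
  fix i j
  assume ij: "(i, j) \<in> H"
  have anti: "x = y" if "(x, y) \<in> H\<^sup>*" "(y, x) \<in> H\<^sup>*" for x y
    using acyclic_impl_antisym_rtrancl[OF assms(1)] that by (rule antisymD)
  have "z = j" if z: "(i, z) \<in> H\<^sup>*" "(z, j) \<in> H\<^sup>*" "z \<noteq> i" for z
  proof -
    obtain k where "(i, k) \<in> H" "(k, z) \<in> H\<^sup>*"
      using z(1,3) by (metis converse_rtranclE)
    then show ?thesis
      using single_valuedD[OF assms(2) ij] z(2) anti by blast
  qed
  moreover have "i \<noteq> j"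
    using ij assms(1) by (auto simp: acyclic_def)
  ultimately show "(i, j) \<in> hasse (H\<^sup>* \<inter> V \<times> V)"
    using ij assms(3) by (auto simp: hasse_def)
qed

section \<open>From interval-posets to noncrossing trees\<close>

lemma hat_interval:
  assumes "interval_poset n P" "(a, c) \<in> hat n P" "between a c b"
  shows "(b, c) \<in> hat n P"
proof (cases "c = n + 1")
  case True
  then show ?thesis
    using assms(2,3) partial_order_onD(4)[of "{1..n}" P] assms(1)
    by (auto simp: hat_def between_def interval_poset_def)
next
  case False
  then have ac: "(a, c) \<in> P" "a \<in> {1..n}" "c \<in> {1..n}"
    using assms(1,2) partial_order_onD(4)[of "{1..n}" P] by (auto simp: hat_def interval_poset_def)
  have "a < b \<and> b < c \<or> c < b \<and> b < a"
    using assms(3) unfolding between_def by linarith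
  moreover have "b \<in> {1..n}"
    using assms(3) ac by (auto simp: between_def)
  ultimately have "(b, c) \<in> P"
    using assms(1) ac unfolding interval_poset_def by blast
  then show ?thesis
    by (simp add: hat_def)
qed

text \<open>
  Let \<open>x < z\<close> both cover \<open>y\<close>. If \<open>y\<close> is not between them, the interval condition makes
  them comparable, so one of the two is not a cover. If \<open>x < y < z\<close>, the two covers form the
  forbidden pattern when \<open>z \<le> n\<close>, and \<open>x\<close> lies below \<open>z\<close> when \<open>z = n + 1\<close>.
\<close>

lemma single_valued_hasse_hat:
  assumes exc: "exceptional_interval_poset n P"
  shows "single_valued (hasse (hat n P))"
proof -
  have ip: "interval_poset n P"
    using exc by (simp add: exceptional_interval_poset_def)
  then have P: "P \<subseteq> {1..n} \<times> {1..n}"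
    using partial_order_onD(4) by (auto simp: interval_poset_def)
  have False if H: "(y, x) \<in> hasse (hat n P)" "(y, z) \<in> hasse (hat n P)" and "x < z" for x y z
  proof -
    note R = H[THEN hasseD]
    have V: "x \<in> {1..n+1}" "y \<in> {1..n+1}" "z \<in> {1..n+1}"
      using R P by (auto simp: hat_def)
    consider "y < x" | "z < y" | "x < y" "y < z"
      using R \<open>x < z\<close> by linarith
    then show False
    proof cases
      case 1
      then have "(x, z) \<in> hat n P"
        using hat_interval[OF ip, of y z x] R \<open>x < z\<close> by (auto simp: between_def)
      then show False
        using hasse_no_middle[OF H(2), of x] R \<open>x < z\<close> by auto
    next
      case 2
      then have "(z, x) \<in> hat n P"
        using hat_interval[OF ip, of y x z] R \<open>x < z\<close> by (auto simp: between_def)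
      then show False
        using hasse_no_middle[OF H(1), of z] R \<open>x < z\<close> by auto
    next
      case 3
      show False
      proof (cases "z = n + 1")
        case True
        then have "(x, z) \<in> hat n P"
          using V by (auto simp: hat_def)
        then show False
          using hasse_no_middle[OF H(2), of x] R \<open>x < z\<close> by auto
      next
        case False
        then have "(y, x) \<in> hasse P" "(y, z) \<in> hasse P"
          unfolding hasse_hat_restrict[OF P, symmetric] using H V 3 by auto
        then show False
          using exc 3 unfolding exceptional_interval_poset_def by blast
      qed
    qed
  qed
  then show ?thesis
    unfolding single_valued_def by (metis linorder_neqE_nat)
qed

text \<open>
  If the covers interleave, then one of \<open>b, d\<close> is between \<open>a\<close> and \<open>c\<close> and thus below \<open>c\<close>; as
  \<open>d\<close> is the only cover of \<open>b\<close>, in both cases \<open>d\<close> is below \<open>c\<close>. By symmetry \<open>c\<close> is below \<open>d\<close>.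
\<close>

lemma covers_do_not_cross:
  assumes R: "partial_order_on A R" "finite A"
    and interval: "\<And>a b c. (a, c) \<in> R \<Longrightarrow> between a c b \<Longrightarrow> (b, c) \<in> R"
    and sv: "single_valued (hasse R)"
    and H: "(a, c) \<in> hasse R" "(b, d) \<in> hasse R" and disj: "{a, c} \<inter> {b, d} = {}"
  shows "between a c b = between a c d"
proof (rule ccontr)
  assume ne: "between a c b \<noteq> between a c d"
  then have ne': "between b d a \<noteq> between b d c"
    using between_swap[OF disj] by simp
  \<comment> \<open>Since covers are unique, everything strictly above \<open>x\<close> is above its cover.\<close>
  have step: "(y, z) \<in> R" if xy: "(x, y) \<in> hasse R" and xz: "(x, z) \<in> R" "x \<noteq> z" for x y z
  proof -
    have "(x, z) \<in> (hasse R)\<^sup>*" and A: "y \<in> A" "z \<in> A"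
      using xz order_eq_hasse_rtrancl[OF R] partial_order_onD(4)[OF R(1)] hasseD[OF xy] by auto
    then obtain k where "(x, k) \<in> hasse R" "(k, z) \<in> (hasse R)\<^sup>*"
      using xz(2) by (metis converse_rtranclE)
    then have "(y, z) \<in> (hasse R)\<^sup>*"
      using single_valuedD[OF sv xy] by blast
    then show ?thesis
      using order_eq_hasse_rtrancl[OF R] A by blast
  qed
  have "(d, c) \<in> R"
  proof (cases "between a c d")
    case False
    then have "(b, c) \<in> R"
      using ne interval H(1)[THEN hasseD] by blast
    then show ?thesis
      using step[OF H(2)] disj by blast
  qed (use interval H(1)[THEN hasseD] in blast)
  moreover have "(c, d) \<in> R"
  proof (cases "between b d c")
    case False
    then have "(a, d) \<in> R"
      using ne' interval H(2)[THEN hasseD] by blast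
    then show ?thesis
      using step[OF H(1)] disj by blast
  qed (use interval H(2)[THEN hasseD] in blast)
  ultimately show False
    using antisymD[OF partial_order_onD(3)[OF R(1)]] disj by blast
qed

lemma theta_noncrossing_tree:
  assumes exc: "exceptional_interval_poset n P"
  shows "noncrossing_tree n (theta n P)" and "oriented_edges n (theta n P) = hasse (hat n P)"
proof -
  define R H V where "R = hat n P" and "H = hasse R" and "V = {1..n+1}"
  have ip: "interval_poset n P"
    using exc by (simp add: exceptional_interval_poset_def)
  then have R: "partial_order_on V R"
    using partial_order_on_hat by (simp add: R_def V_def interval_poset_def)
  have fin: "finite V"
    by (simp add: V_def)
  have sv: "single_valued H"
    using single_valued_hasse_hat[OF exc] by (simp add: H_def R_def)
  have RV: "R \<subseteq> V \<times> V"
    using partial_order_onD(4)[OF R] .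
  have HR: "H \<subseteq> R - Id"
    by (auto simp: H_def hasse_def)
  have HV: "H \<subseteq> V \<times> V"
    using HR RV by blast
  have "finite R"
    using finite_subset[OF RV] fin by simp
  then have "wf (R - Id)"
    using R by (rule partial_order_on_well_order_on)
  then have wf: "wf H"
    using HR by (rule wf_subset)
  have root: "(n + 1, j) \<notin> H" for j
  proof
    assume j: "(n + 1, j) \<in> H"
    then have "(j, n + 1) \<in> R"
      using HV by (auto simp: R_def hat_def V_def)
    then show False
      using j HR antisymD[OF partial_order_onD(3)[OF R], of j "n + 1"] by auto
  qed
  have reach: "(x, n + 1) \<in> H\<^sup>*" if "x \<in> V" for x
  proof -
    have "(x, n + 1) \<in> R"
      using that by (auto simp: R_def hat_def V_def)
    then show ?thesis
      using order_eq_hasse_rtrancl[OF R fin] by (auto simp: H_def)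
  qed
  have top: "n + 1 \<in> V"
    by (simp add: V_def)
  have theta: "theta n P = edges_of H"
    by (simp add: theta_def edges_of_def H_def R_def)
  show "oriented_edges n (theta n P) = hasse (hat n P)"
    using oriented_edges_edges_of[OF sv root reach HV top] by (simp add: theta H_def R_def)
  have "\<not> crossing n e f" if ef: "e \<in> edges_of H" "f \<in> edges_of H" "e \<noteq> f" for e f
  proof -
    obtain a c b d where e: "e = {a, c}" "(a, c) \<in> H" and f: "f = {b, d}" "(b, d) \<in> H"
      using ef unfolding edges_of_def by blast
    have "a \<noteq> c" "b \<noteq> d" "{a, c, b, d} \<subseteq> V"
      using e f HR HV by auto
    moreover have "between a c b = between a c d" if "{a, c} \<inter> {b, d} = {}"
      using covers_do_not_cross[OF R fin, of a c b d] hat_interval[OF ip] sv e f that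
      by (simp add: H_def R_def)
    ultimately show ?thesis
      using ef(3) crossing_iff[of a c b d n] e f by (auto simp: V_def)
  qed
  then have "\<forall>e\<in>edges_of H. \<forall>f\<in>edges_of H. e \<noteq> f \<longrightarrow> \<not> crossing n e f"
    by simp
  moreover have "\<forall>e\<in>edges_of H. \<exists>x\<in>V. \<exists>y\<in>V. x \<noteq> y \<and> e = {x, y}"
    using HR HV unfolding edges_of_def by blast
  moreover have "\<forall>x\<in>V. \<forall>y\<in>V. \<exists>p. is_path (edges_of H) p \<and> hd p = x \<and> last p = y"
    using path_if_reachable[OF reach] by simp
  ultimately show "noncrossing_tree n (theta n P)"
    using edges_of_single_valued_acyclic[OF wf sv]
    unfolding noncrossing_tree_def theta V_def by (intro conjI)
qed

lemma theta_inv_eqI: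
  assumes "partial_order_on {1..n} P" "hasse P = tree_relations n T"
  shows "theta_inv n T = P"
  unfolding theta_inv_def
proof (rule the_equality)
  fix Q
  assume "partial_order_on {1..n} Q \<and> hasse Q = tree_relations n T"
  then show "Q = P"
    using assms order_eq_hasse_rtrancl[of "{1..n}"] by (metis finite_atLeastAtMost)
qed (use assms in blast)

lemma theta_inv_theta:
  assumes "exceptional_interval_poset n P"
  shows "theta_inv n (theta n P) = P"
proof (rule theta_inv_eqI)
  show po: "partial_order_on {1..n} P"
    using assms by (simp add: exceptional_interval_poset_def interval_poset_def)
  show "hasse P = tree_relations n (theta n P)"
    using hasse_hat_restrict[OF partial_order_onD(4)[OF po]] theta_noncrossing_tree(2)[OF assms]
    by (simp add: tree_relations_def)
qed

section \<open>From noncrossing trees to interval-posets\<close>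

context
  fixes n :: nat and T :: "nat set set"
  assumes tree: "noncrossing_tree n T"
begin

lemma edge_in_circle:
  assumes "{i, j} \<in> T"
  shows "i \<in> {1..n+1}" "j \<in> {1..n+1}" "i \<noteq> j"
proof -
  obtain x y where "x \<in> {1..n+1}" "y \<in> {1..n+1}" "x \<noteq> y" "{i, j} = {x, y}"
    using bspec[OF conjunct1[OF tree[unfolded noncrossing_tree_def]] assms] by blast
  then show "i \<in> {1..n+1}" "j \<in> {1..n+1}" "i \<noteq> j"
    by (auto simp: doubleton_eq_iff)
qed

lemma no_cycle: "\<nexists>p. is_cycle T p"
  using tree by (simp add: noncrossing_tree_def)

lemma ex_path_to_root: "x \<in> {1..n+1} \<Longrightarrow> \<exists>p. is_path T p \<and> hd p = x \<and> last p = n + 1"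
  using tree by (auto simp: noncrossing_tree_def)

lemma oriented_edge: "(i, j) \<in> oriented_edges n T \<Longrightarrow> {i, j} \<in> T"
  by (auto simp: oriented_edges_iff is_path_Cons)

lemma oriented_edges_in_circle: "oriented_edges n T \<subseteq> {1..n+1} \<times> {1..n+1}"
  using edge_in_circle(1,2)[OF oriented_edge] by auto

lemma single_valued_oriented_edges: "single_valued (oriented_edges n T)"
proof (rule single_valuedI)
  fix i j k
  assume "(i, j) \<in> oriented_edges n T" "(i, k) \<in> oriented_edges n T"
  then obtain q r where
    "is_path T (i # j # q)" "last (j # q) = n + 1" "is_path T (i # k # r)" "last (k # r) = n + 1"
    unfolding oriented_edges_iff by blast
  then show "j = k"
    using path_unique[OF no_cycle, of "i # j # q" "i # k # r"] by simp
qed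

text \<open>
  By uniqueness of paths, the simple path from \<open>i\<close> to the root runs through everything that
  is reachable from \<open>i\<close>; this is why orientations cannot close up to a cycle.
\<close>

lemma trancl_oriented_edges_path:
  assumes "(i, j) \<in> (oriented_edges n T)\<^sup>+"
  shows "\<exists>u w. is_path T (i # u @ j # w) \<and> last (j # w) = n + 1"
  using assms
proof (induction rule: trancl_induct)
  case (base j)
  then show ?case
    by (metis append_Nil oriented_edges_iff)
next
  case (step j k)
  then obtain u w q where w: "is_path T ((i # u) @ j # w)" "last (j # w) = n + 1"
    and q: "is_path T (j # k # q)" "last (k # q) = n + 1"
    by (auto simp: oriented_edges_iff)
  have "j # w = j # k # q"
    using path_unique[OF no_cycle is_path_suffix[OF w(1)] q(1)] w(2) q(2) by simp
  then have "is_path T (i # (u @ [j]) @ k # q)"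
    using w(1) by simp
  with q(2) show ?case by blast
qed

lemma acyclic_oriented_edges: "acyclic (oriented_edges n T)"
proof (rule acyclicI, clarify)
  fix i
  assume "(i, i) \<in> (oriented_edges n T)\<^sup>+"
  then obtain u w where "is_path T (i # u @ i # w)"
    using trancl_oriented_edges_path by blast
  then show False
    by (simp add: is_path_def)
qed

lemma root_not_oriented: "(n + 1, j) \<notin> oriented_edges n T"
proof
  assume "(n + 1, j) \<in> oriented_edges n T"
  then obtain q where "is_path T ((n + 1) # j # q)" "last (j # q) = n + 1"
    unfolding oriented_edges_iff by blast
  then show False
    using last_in_set[of "j # q"] by (simp add: is_path_def)
qed

lemma reaches_root:
  assumes "x \<in> {1..n+1}"
  shows "(x, n + 1) \<in> (oriented_edges n T)\<^sup>*"
proof -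
  have "(hd p, n + 1) \<in> (oriented_edges n T)\<^sup>*" if "is_path T p" "last p = n + 1" for p
    using that
  proof (induction p rule: induct_list012)
    case (3 x y q)
    have "(x, y) \<in> oriented_edges n T"
      unfolding oriented_edges_iff using "3.prems" by (intro exI[of _ q]) simp
    moreover have "is_path T (y # q)" "last (y # q) = n + 1"
      using "3.prems" by (simp_all add: is_path_Cons)
    then have "(y, n + 1) \<in> (oriented_edges n T)\<^sup>*"
      using "3.IH"(2) by simp
    ultimately show ?case by simp
  qed (simp_all add: is_path_def)
  then show ?thesis
    using ex_path_to_root[OF assms] by blast
qed

text \<open>
  If the path from \<open>i\<close> to the root avoids \<open>j\<close>, it extends to a path from \<open>j\<close>. If it meets \<open>j\<close>,
  it does so in its first step, as otherwise the edge would close a cycle.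
\<close>

lemma edge_oriented:
  assumes "{i, j} \<in> T"
  shows "(i, j) \<in> oriented_edges n T \<or> (j, i) \<in> oriented_edges n T"
proof -
  obtain p where p: "is_path T p" "hd p = i" "last p = n + 1"
    using ex_path_to_root edge_in_circle[OF assms] by blast
  then obtain q where q: "p = i # q"
    by (cases p) (auto simp: is_path_def)
  show ?thesis
  proof (cases "j \<in> set p")
    case False
    then have "is_path T (j # i # q)"
      using p(1) assms by (auto simp: q is_path_Cons insert_commute)
    moreover have "last (i # q) = n + 1"
      using p(3) by (simp add: q)
    ultimately show ?thesis
      unfolding oriented_edges_iff by blast
  next
    case True
    then obtain u w where uw: "q = u @ j # w"
      using edge_in_circle(3)[OF assms] split_list[of j q] by (auto simp: q)
    have "is_path T ((i # u @ [j]) @ w)"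
      using p(1) by (simp add: q uw)
    then have "is_path T (i # u @ [j])"
      using is_path_prefix by blast
    then have "u = []"
      using no_cycle assms by (cases u) (force simp: is_cycle_def insert_commute)+
    then have "is_path T (i # j # w)" "last (j # w) = n + 1"
      using p(1,3) by (simp_all add: q uw)
    then show ?thesis
      unfolding oriented_edges_iff by blast
  qed
qed

lemma edges_of_oriented_edges: "edges_of (oriented_edges n T) = T"
proof (rule set_eqI, rule iffI)
  fix e
  assume e: "e \<in> T"
  then obtain x y where "e = {x, y}"
    using bspec[OF conjunct1[OF tree[unfolded noncrossing_tree_def]] e] by blast
  then show "e \<in> edges_of (oriented_edges n T)"
    using e edge_oriented[of x y] by (simp only: edges_of_iff)
qed (use oriented_edge in \<open>auto simp: edges_of_def\<close>)

lemma edges_do_not_separate: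
  assumes "{a, b} \<in> T" "{c, d} \<in> T" "{a, b} \<inter> {c, d} = {}"
  shows "between a b c = between a b d"
proof -
  have "{a, b} \<noteq> {c, d}"
    using assms(3) by auto
  then have "\<not> crossing n {a, b} {c, d}"
    using tree assms(1,2) by (simp add: noncrossing_tree_def)
  then show ?thesis
    using crossing_iff[of a b c d n] edge_in_circle[OF assms(1)] edge_in_circle[OF assms(2)]
      assms(3) \<open>{a, b} \<noteq> {c, d}\<close> by auto
qed

text \<open>
  If \<open>b\<close> does not reach \<open>c\<close>, its path to the root never meets the path from \<open>a\<close> to \<open>c\<close>. An
  edge \<open>v, w\<close> of the former crosses no edge of the latter, so the path from \<open>a\<close> to \<open>c\<close> stays on one side
  of it; hence \<open>v\<close> and \<open>w\<close> lie on the same side of \<open>a, c\<close>. Step by step, the path from \<open>b\<close> thus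
  stays between \<open>a\<close> and \<open>c\<close> and cannot reach the largest label \<open>n + 1\<close>.
\<close>

lemma reachability_interval:
  assumes ac: "(a, c) \<in> (oriented_edges n T)\<^sup>*" and b: "between a c b"
    and V: "a \<in> {1..n+1}" "b \<in> {1..n+1}" "c \<in> {1..n+1}"
  shows "(b, c) \<in> (oriented_edges n T)\<^sup>*"
proof (rule ccontr)
  let ?O = "oriented_edges n T"
  assume bc: "(b, c) \<notin> ?O\<^sup>*"
  have "between a c v" if "(b, v) \<in> ?O\<^sup>*" for v
    using that
  proof (induction rule: rtrancl_induct)
    case (step v w)
    have "(b, w) \<in> ?O\<^sup>*"
      using step(1,2) by (rule rtrancl.rtrancl_into_rtrancl)
    then have avoid: "x \<notin> {v, w}" if "(x, c) \<in> ?O\<^sup>*" for x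
      using bc rtrancl_trans[OF step(1), of c] rtrancl_trans[of b w ?O c] that by blast
    have "between v w a = between v w c"
      using ac
    proof (induction rule: converse_rtrancl_induct)
      case (step x y)
      then have "x \<notin> {v, w}" "y \<notin> {v, w}"
        using avoid[OF converse_rtrancl_into_rtrancl[of x y]] avoid[of y] by blast+
      then have "between v w x = between v w y"
        using oriented_edge[OF step(1)] oriented_edge[OF \<open>(v, w) \<in> ?O\<close>]
        by (intro edges_do_not_separate) auto
      then show ?case using step by simp
    qed simp
    moreover have "{v, w} \<inter> {a, c} = {}"
      using avoid ac by blast
    ultimately show ?case
      using between_swap step(3) by blast
  qed (rule b)
  then have "between a c (n + 1)"
    using reaches_root[OF V(2)] by blast
  then show False
    using V by (auto simp: between_def)
qed

lemma noncrossing_tree_poset: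
  obtains P where "exceptional_interval_poset n P" "hasse P = tree_relations n T" "theta n P = T"
proof -
  let ?O = "oriented_edges n T"
  define P where "P = ?O\<^sup>* \<inter> {1..n} \<times> {1..n}"
  have po: "partial_order_on {1..n} P"
    unfolding P_def using acyclic_oriented_edges by (rule partial_order_on_rtrancl)
  have "hat n P = ?O\<^sup>* \<inter> {1..n+1} \<times> {1..n+1}"
  proof -
    have "j = n + 1" if "(n + 1, j) \<in> ?O\<^sup>*" for j
      using that root_not_oriented by (metis converse_rtranclE)
    then show ?thesis
      using reaches_root by (fastforce simp: hat_def P_def le_Suc_eq)
  qed
  then have hat: "hasse (hat n P) = ?O"
    using hasse_rtrancl[OF acyclic_oriented_edges single_valued_oriented_edges oriented_edges_in_circle]
    by simp
  have hasse: "hasse P = tree_relations n T"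
    using hasse_hat_restrict[OF partial_order_onD(4)[OF po]] by (simp add: hat tree_relations_def)
  have "(b, c) \<in> P" if "(a, c) \<in> P" "between a c b" for a b c
  proof -
    have "b \<in> {1..n}"
      using that by (auto simp: P_def between_def)
    then show ?thesis
      using that reachability_interval[of a c b] by (auto simp: P_def)
  qed
  then have "interval_poset n P"
    using po by (auto simp: interval_poset_def between_def)
  moreover have "\<not> (\<exists>x y z. x < y \<and> y < z \<and> (y, z) \<in> hasse P \<and> (y, x) \<in> hasse P)"
  proof -
    have "z = x" if "(y, z) \<in> hasse P" "(y, x) \<in> hasse P" for x y z
      using that single_valuedD[OF single_valued_oriented_edges] unfolding hasse tree_relations_def
      by blast
    then show ?thesis
      by (metis less_asym)
  qed
  ultimately have "exceptional_interval_poset n P"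
    by (simp add: exceptional_interval_poset_def)
  moreover have "theta n P = T"
    using edges_of_oriented_edges by (simp add: theta_def edges_of_def hat)
  ultimately show thesis
    using that hasse by blast
qed

end

lemma theta_inv_noncrossing_tree:
  assumes "noncrossing_tree n T"
  shows "exceptional_interval_poset n (theta_inv n T)"
    and "hasse (theta_inv n T) = tree_relations n T"
    and "theta n (theta_inv n T) = T"
proof -
  obtain P where P: "exceptional_interval_poset n P" "hasse P = tree_relations n T" "theta n P = T"
    using noncrossing_tree_poset[OF assms] .
  then have "theta_inv n T = P"
    using theta_inv_theta by blast
  with P show "exceptional_interval_poset n (theta_inv n T)"
    "hasse (theta_inv n T) = tree_relations n T" "theta n (theta_inv n T) = T"
    by simp_all
qed

theorem theorem4p6:
  fixes n :: nat
  assumes "n \<ge> 1"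
  shows "(\<forall>P. exceptional_interval_poset n P \<longrightarrow> noncrossing_tree n (theta n P)) \<and>
    (\<forall>T. noncrossing_tree n T \<longrightarrow>
       exceptional_interval_poset n (theta_inv n T) \<and>
       hasse (theta_inv n T) = tree_relations n T) \<and>
    (bij_betw (theta n) {P. exceptional_interval_poset n P} {T. noncrossing_tree n T} \<and>
     (\<forall>P. exceptional_interval_poset n P \<longrightarrow> theta_inv n (theta n P) = P) \<and>
     (\<forall>T. noncrossing_tree n T \<longrightarrow> theta n (theta_inv n T) = T))"
proof -
  have "bij_betw (theta n) {P. exceptional_interval_poset n P} {T. noncrossing_tree n T}"
    by (rule bij_betwI[where g = "theta_inv n"])
      (auto simp: theta_noncrossing_tree(1) theta_inv_noncrossing_tree theta_inv_theta)
  then show ?thesis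
    by (simp add: theta_noncrossing_tree(1) theta_inv_noncrossing_tree theta_inv_theta)
qed

end
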